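(* Let $S$ be a Boolean inverse $\wedge$-monoid. Then $\mathsf{G}(S)$ is principal if and only if each $s\in S$ can be written as $s=e\vee s_1\vee\dots\vee s_m$ for some $m\ge 0$, where $e$ is an idempotent, each $s_i$ ($1\le i\le m$) is an infinitesimal, and $e\perp (s_1\vee\dots\vee s_m)$. Moreover, in this case the $s_i$ may also be chosen to be pairwise orthogonal.
   Context: An inverse semigroup is a semigroup $S$ in which each $s$ has a unique $s^{-1}$ with $s=ss^{-1}s$, $s^{-1}=s^{-1}ss^{-1}$. All inverse monoids have a zero $0$. $E(S)$ is the set of idempotents (they commute), ordered by $e\le f\iff e=ef$. The natural partial order is $s\le t\iff s=ts^{-1}s$; meets $\wedge$ and joins $\vee$ are taken with respect to it (the empty join is $0$). $a,b$ are compatible if $ab^{-1}$ and $a^{-1}b$ are idempotents, and orthogonal, $a\perp b$, if $ab^{-1}=0=a^{-1}b$. $S$ is distributive if every compatible pair has a join and multiplication distributes over all binary joins that exist. A Boolean inverse monoid is a distributive inverse monoid whose idempotents form a Boolean algebra; it is a Boolean inverse $\wedge$-monoid if in addition every pair of elements has a meet. An infinitesimal is a non-zero $s\in S$ with $s^2=0$. $\mathsf{G}(S)$ is the set of ultrafilters of $S$ (maximal among nonempty subsets not containing $0$ that are closed under finite meets and upward closed), a groupoid with $\mathbf{d}(A)=(A^{-1}A)^{\uparrow}$, $\mathbf{r}(A)=(AA^{-1})^{\uparrow}$ (upward closures) and product $A\cdot B=(AB)^{\uparrow}$ when $\mathbf{d}(A)=\mathbf{r}(B)$, topologized by the basis $V_a=\{A: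 a\in A\}$, $a\in S$. A groupoid $G$ is principal if $\{g\in G: g^{-1}g=gg^{-1}\}$ consists only of identities. *)

theory Defs
  imports Main
begin

definition is_sup :: "('a \<Rightarrow> 'a \<Rightarrow> bool) \<Rightarrow> 'a set \<Rightarrow> 'a set \<Rightarrow> 'a \<Rightarrow> bool" where
  "is_sup le P X z \<longleftrightarrow>
     z \<in> P \<and> (\<forall>x\<in>X. le x z) \<and> (\<forall>u\<in>P. (\<forall>x\<in>X. le x u) \<longrightarrow> le z u)"

definition is_inf :: "('a \<Rightarrow> 'a \<Rightarrow> bool) \<Rightarrow> 'a set \<Rightarrow> 'a set \<Rightarrow> 'a \<Rightarrow> bool" where
  "is_inf le P X z \<longleftrightarrow>
     z \<in> P \<and> (\<forall>x\<in>X. le z x) \<and> (\<forall>u\<in>P. (\<forall>x\<in>X. le u x) \<longrightarrow> le u z)"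

text \<open>The class \<open>boolean_algebra\<close> of the library concerns whole types; here the carrier is a
  subset and the order is an explicit relation. The one-element Boolean algebra is allowed.\<close>

definition boolean_algebra_on :: "'a set \<Rightarrow> ('a \<Rightarrow> 'a \<Rightarrow> bool) \<Rightarrow> bool" where
  "boolean_algebra_on P le \<longleftrightarrow>
     reflp_on P le \<and> antisymp_on P le \<and> transp_on P le \<and>
     (\<exists>bt tp join meet compl.
        bt \<in> P \<and> tp \<in> P \<and> (\<forall>x\<in>P. le bt x \<and> le x tp) \<and>
        (\<forall>x\<in>P. \<forall>y\<in>P. is_sup le P {x, y} (join x y) \<and> is_inf le P {x, y} (meet x y)) \<and>
        (\<forall>x\<in>P. \<forall>y\<in>P. \<forall>z\<in>P. meet x (join y z) = join (meet x y) (meet x z)) \<and>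
        (\<forall>x\<in>P. compl x \<in> P \<and> meet x (compl x) = bt \<and> join x (compl x) = tp))"


context times
begin

definition sinv :: "'a \<Rightarrow> 'a" where
  "sinv s = (THE t. s = s * t * s \<and> t = t * s * t)"

definition idempotents :: "'a set" where
  "idempotents = {e. e * e = e}"

definition nle :: "'a \<Rightarrow> 'a \<Rightarrow> bool"  (infix \<open>\<preceq>\<close> 50) where
  "s \<preceq> t \<longleftrightarrow> s = t * sinv s * s"

definition is_join :: "'a set \<Rightarrow> 'a \<Rightarrow> bool" where
  "is_join X z \<longleftrightarrow> is_sup nle UNIV X z"

definition is_meet :: "'a set \<Rightarrow> 'a \<Rightarrow> bool" where
  "is_meet X z \<longleftrightarrow> is_inf nle UNIV X z"

definition compatible :: "'a \<Rightarrow> 'a \<Rightarrow> bool" where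
  "compatible a b \<longleftrightarrow> a * sinv b \<in> idempotents \<and> sinv a * b \<in> idempotents"

end


class inverse_semigroup = semigroup_mult +
  assumes unique_inverse: "\<exists>!t. s = s * t * s \<and> t = t * s * t"

class inverse_monoid = inverse_semigroup + monoid_mult + mult_zero

class distributive_inverse_monoid = inverse_monoid +
  assumes compatible_join: "compatible a b \<Longrightarrow> \<exists>j. is_join {a, b} j"
    and mult_join_left: "is_join {a, b} j \<Longrightarrow> is_join {c * a, c * b} (c * j)"
    and mult_join_right: "is_join {a, b} j \<Longrightarrow> is_join {a * c, b * c} (j * c)"

class boolean_inverse_monoid = distributive_inverse_monoid +
  assumes idempotents_boolean: "boolean_algebra_on idempotents nle"

class boolean_inverse_meet_monoid = boolean_inverse_monoid +
  assumes ex_meet: "\<exists>m. is_meet {a, b} m"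


definition orthogonal :: "'a::inverse_monoid \<Rightarrow> 'a \<Rightarrow> bool" where
  "orthogonal a b \<longleftrightarrow> a * sinv b = 0 \<and> sinv a * b = 0"

definition infinitesimal :: "'a::inverse_monoid \<Rightarrow> bool" where
  "infinitesimal s \<longleftrightarrow> s \<noteq> 0 \<and> s * s = 0"


text \<open>The arrows of a groupoid include its objects, which are identified with the identities;
  \<open>gcomp G g h\<close> is meaningful only when \<open>source G g = target G h\<close>.\<close>

record 'g groupoid =
  arrows :: "'g set"
  source :: "'g \<Rightarrow> 'g"
  target :: "'g \<Rightarrow> 'g"
  gcomp :: "'g \<Rightarrow> 'g \<Rightarrow> 'g"
  ginv :: "'g \<Rightarrow> 'g"

definition identities :: "'g groupoid \<Rightarrow> 'g set" where
  "identities G = source G ` arrows G"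

definition principal_groupoid :: "'g groupoid \<Rightarrow> bool" where
  "principal_groupoid G \<longleftrightarrow>
     {g \<in> arrows G. gcomp G (ginv G g) g = gcomp G g (ginv G g)} \<subseteq> identities G"


definition up_closure :: "'a::inverse_monoid set \<Rightarrow> 'a set" where
  "up_closure A = {t. \<exists>a\<in>A. a \<preceq> t}"

definition set_mult :: "'a::inverse_monoid set \<Rightarrow> 'a set \<Rightarrow> 'a set" where
  "set_mult A B = {a * b | a b. a \<in> A \<and> b \<in> B}"

definition proper_filter :: "'a::inverse_monoid set \<Rightarrow> bool" where
  "proper_filter A \<longleftrightarrow>
     A \<noteq> {} \<and> 0 \<notin> A \<and>
     (\<forall>a\<in>A. \<forall>b\<in>A. \<forall>m. is_meet {a, b} m \<longrightarrow> m \<in> A) \<and>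
     (\<forall>a\<in>A. \<forall>t. a \<preceq> t \<longrightarrow> t \<in> A)"

definition ultrafilter :: "'a::inverse_monoid set \<Rightarrow> bool" where
  "ultrafilter A \<longleftrightarrow>
     proper_filter A \<and> (\<forall>B. proper_filter B \<longrightarrow> A \<subseteq> B \<longrightarrow> B = A)"

text \<open>The underlying groupoid of \<open>\<G>(S)\<close>, where \<open>S\<close> is the whole type \<open>'a\<close>.\<close>

definition ultrafilter_groupoid :: "'a::boolean_inverse_meet_monoid set groupoid" where
  "ultrafilter_groupoid =
     \<lparr> arrows = {A. ultrafilter A},
       source = (\<lambda>A. up_closure (set_mult (sinv ` A) A)),
       target = (\<lambda>A. up_closure (set_mult A (sinv ` A))),
       gcomp = (\<lambda>A B. up_closure (set_mult A B)),
       ginv = (\<lambda>A. sinv ` A) \<rparr>"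


text \<open>\<open>infinitesimal_decomposition s e m f\<close> says that
  \<open>s = e \<or> f 1 \<or> \<dots> \<or> f m\<close> with \<open>e\<close> idempotent, each \<open>f i\<close> infinitesimal, and
  \<open>e\<close> orthogonal to \<open>f 1 \<or> \<dots> \<or> f m\<close>, which is \<open>0\<close> for \<open>m = 0\<close>.\<close>

definition infinitesimal_decomposition ::
    "'a::inverse_monoid \<Rightarrow> 'a \<Rightarrow> nat \<Rightarrow> (nat \<Rightarrow> 'a) \<Rightarrow> bool" where
  "infinitesimal_decomposition s e m f \<longleftrightarrow>
     e \<in> idempotents \<and> (\<forall>i\<in>{1..m}. infinitesimal (f i)) \<and>
     is_join (insert e (f ` {1..m})) s \<and>
     (\<exists>t. is_join (f ` {1..m}) t \<and> orthogonal e t)"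

end

theory Submission
  imports Defs
begin

text \<open>The identities of the groupoid are exactly the ultrafilters that contain an idempotent, so it
  is principal iff every ultrafilter \<open>A\<close> without idempotents has different source and target. The
  link to infinitesimals is that an ultrafilter has different source and target iff it contains
  an element of square zero. Such an element has orthogonal domain and range, which separates
  source from target (\<open>isotropy_no_square_zero\<close>). Conversely, an idempotent \<open>f\<close> that lies in just
  one of the two gives, by cutting an element of \<open>A\<close> down with the complement of \<open>f\<close>, an element
  of \<open>A\<close> that maps a part of \<open>f\<close> outside \<open>f\<close> or vice versa, hence has square zero
  (\<open>anisotropic_has_square_zero\<close>).

  If every element decomposes and source and target of \<open>A\<close> agree, decompose some \<open>s \<in> A\<close>.
  Ultrafilters are prime (\<open>ultrafilter_finite_join_prime\<close>), so \<open>A\<close> contains the idempotent or one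
  of the infinitesimals. The latter is impossible, and so \<open>A\<close> is an identity.

  If the groupoid is principal, split \<open>s\<close> into its largest idempotent part \<open>e = s \<and> 1\<close> and a rest
  \<open>t\<close> orthogonal to \<open>e\<close>, with no nonzero idempotent below it. Every ultrafilter that contains \<open>t\<close>
  contains an infinitesimal below \<open>t\<close>. Compactness of the set of ultrafilters containing \<open>t\<close>,
  which appears here as an extension of a filter to an ultrafilter (\<open>principal_compact_cover\<close>),
  shows that finitely many infinitesimals cover \<open>t\<close>. Removing from each what the
  earlier ones cover makes them orthogonal (\<open>orthogonal_infinitesimals_cover\<close>), which is why the
  stronger form of the decomposition comes for free.\<close>

section \<open>Inverse semigroups and the natural partial order\<close>

lemma sinv_sandwich:
  fixes s :: "'a::inverse_semigroup"
  shows "s * (sinv s * s) = s" and "sinv s * (s * sinv s) = sinv s"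
proof -
  have "s = s * sinv s * s \<and> sinv s = sinv s * s * sinv s"
    unfolding sinv_def by (rule theI'[OF unique_inverse])
  then show "s * (sinv s * s) = s" and "sinv s * (s * sinv s) = sinv s"
    by (simp_all add: mult.assoc)
qed

lemma sinv_sandwich_assoc:
  fixes s :: "'a::inverse_semigroup"
  shows "s * (sinv s * (s * z)) = s * z" and "sinv s * (s * (sinv s * z)) = sinv s * z"
  by (metis sinv_sandwich mult.assoc)+

lemmas sinv_simps = sinv_sandwich sinv_sandwich_assoc

lemma sinv_unique:
  fixes s :: "'a::inverse_semigroup"
  assumes "s * t * s = s" and "t * s * t = t"
  shows "sinv s = t"
  using unique_inverse[of s] assms sinv_sandwich[of s] by (metis mult.assoc)

lemma idempotentD:
  fixes e :: "'a::inverse_semigroup"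
  assumes "e \<in> idempotents"
  shows "e * e = e" and "e * (e * z) = e * z"
  using assms unfolding idempotents_def by (auto simp flip: mult.assoc)

lemma idempotentI: "e * e = e \<Longrightarrow> e \<in> idempotents"
  unfolding idempotents_def by simp

lemma sinv_sinv [simp]: "sinv (sinv s) = (s::'a::inverse_semigroup)"
  by (rule sinv_unique) (simp_all add: mult.assoc sinv_simps)

lemma sinv_idempotent: "e \<in> idempotents \<Longrightarrow> sinv e = (e::'a::inverse_semigroup)"
  by (rule sinv_unique) (simp_all add: idempotentD)

lemma domain_idempotent: "sinv s * s \<in> idempotents" for s :: "'a::inverse_semigroup"
  by (rule idempotentI) (simp add: mult.assoc sinv_simps)

lemma range_idempotent: "s * sinv s \<in> idempotents" for s :: "'a::inverse_semigroup"
  by (rule idempotentI) (simp add: mult.assoc sinv_simps)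

text \<open>With \<open>x\<close> the inverse of \<open>e * f\<close>, the idempotent \<open>f * x * e\<close> is another inverse of it. So
  \<open>e * f\<close> is the inverse of an idempotent, hence idempotent itself.\<close>

lemma idempotent_mult:
  fixes e :: "'a::inverse_semigroup"
  assumes e: "e \<in> idempotents" and f: "f \<in> idempotents"
  shows "e * f \<in> idempotents"
proof -
  let ?x = "sinv (e * f)"
  have 1: "e * (f * (?x * (e * f))) = e * f" and 2: "?x * (e * (f * ?x)) = ?x"
    using sinv_sandwich[of "e * f"] by (simp_all add: mult.assoc)
  have 3: "?x * (e * (f * (?x * z))) = ?x * z" for z
    using sinv_sandwich_assoc(2)[of "e * f" z] by (simp add: mult.assoc)
  have x: "?x = f * ?x * e"
    by (rule sinv_unique) (simp_all add: mult.assoc idempotentD[OF e] idempotentD[OF f] 1 3)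
  have "(f * ?x * e) * (f * ?x * e) = f * ?x * e"
    by (simp add: mult.assoc 3)
  then have "?x \<in> idempotents" using x idempotentI by metis
  then show ?thesis using sinv_idempotent sinv_sinv by metis
qed

lemma idempotent_commute:
  fixes e :: "'a::inverse_semigroup"
  assumes e: "e \<in> idempotents" and f: "f \<in> idempotents"
  shows "e * f = f * e"
proof -
  have "e * (f * (e * f)) = e * f" and "f * (e * (f * e)) = f * e"
    using idempotentD(1)[OF idempotent_mult[OF e f]] idempotentD(1)[OF idempotent_mult[OF f e]]
    by (simp_all add: mult.assoc)
  then have "sinv (e * f) = f * e"
    by (intro sinv_unique) (simp_all add: mult.assoc idempotentD[OF e] idempotentD[OF f])
  then show ?thesis using sinv_idempotent[OF idempotent_mult[OF e f]] by simp
qed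

lemma idempotent_left_commute:
  fixes e :: "'a::inverse_semigroup"
  assumes "e \<in> idempotents" and "f \<in> idempotents"
  shows "e * (f * z) = f * (e * z)"
  using idempotent_commute[OF assms] by (metis mult.assoc)

lemma sinv_mult: "sinv (a * b) = sinv b * sinv a" for a :: "'a::inverse_semigroup"
proof (rule sinv_unique)
  have c: "b * (sinv b * (sinv a * (a * z))) = sinv a * (a * (b * (sinv b * z)))" for z
    using idempotent_left_commute[OF range_idempotent[of b] domain_idempotent[of a], of z]
    by (simp add: mult.assoc)
  show "a * b * (sinv b * sinv a) * (a * b) = a * b"
    by (simp add: mult.assoc c sinv_simps)
  have c': "sinv a * (a * (b * (sinv b * z))) = b * (sinv b * (sinv a * (a * z)))" for z
    using c by simp
  show "sinv b * sinv a * (a * b) * (sinv b * sinv a) = sinv b * sinv a"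
    by (simp add: mult.assoc c' sinv_simps)
qed

lemma conjugate_idempotent:
  fixes a :: "'a::inverse_semigroup"
  assumes e: "e \<in> idempotents"
  shows "sinv a * (e * a) \<in> idempotents"
proof (rule idempotentI)
  have "a * (sinv a * (e * a)) = e * a"
    using idempotent_left_commute[OF range_idempotent[of a] e, of a]
    by (simp add: mult.assoc sinv_simps)
  then show "sinv a * (e * a) * (sinv a * (e * a)) = sinv a * (e * a)"
    by (simp add: mult.assoc idempotentD[OF e])
qed

text \<open>An idempotent can be moved across an element at the price of a conjugation.\<close>

lemma idempotent_mult_eq_conjugate:
  fixes a :: "'a::inverse_semigroup"
  assumes "e \<in> idempotents"
  shows "e * a = a * (sinv a * (e * a))"
  using idempotent_left_commute[OF range_idempotent[of a] assms, of a]
  by (simp add: mult.assoc sinv_simps)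

lemma mult_idempotent_eq_conjugate:
  fixes a :: "'a::inverse_semigroup"
  assumes "e \<in> idempotents"
  shows "a * e = (a * (e * sinv a)) * a"
  using idempotent_commute[OF domain_idempotent[of a] assms]
  by (metis mult.assoc sinv_sandwich(1))

lemma nleD: "s \<preceq> t \<Longrightarrow> s = t * (sinv s * s)" for s :: "'a::inverse_semigroup"
  unfolding nle_def by (simp add: mult.assoc)

lemma mult_idempotent_nle:
  fixes t :: "'a::inverse_semigroup"
  assumes e: "e \<in> idempotents"
  shows "t * e \<preceq> t"
proof -
  have "t * (sinv (t * e) * (t * e)) = t * e"
    using idempotent_left_commute[OF e domain_idempotent[of t], of e]
    by (simp add: sinv_mult sinv_idempotent[OF e] mult.assoc sinv_simps idempotentD[OF e])
  then show ?thesis unfolding nle_def by (simp add: mult.assoc)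
qed

lemma idempotent_mult_nle:
  fixes t :: "'a::inverse_semigroup"
  assumes "e \<in> idempotents"
  shows "e * t \<preceq> t"
  using idempotent_mult_eq_conjugate[OF assms, of t] conjugate_idempotent[OF assms]
    mult_idempotent_nle by metis

lemma nleE:
  fixes s :: "'a::inverse_semigroup"
  assumes "s \<preceq> t"
  obtains e where "e \<in> idempotents" and "s = t * e"
  using nleD[OF assms] domain_idempotent by blast

lemma nle_leftE:
  fixes s :: "'a::inverse_semigroup"
  assumes "s \<preceq> t"
  obtains e where "e \<in> idempotents" and "s = e * t"
proof -
  obtain e where e: "e \<in> idempotents" and s: "s = t * e" using assms by (rule nleE)
  show ?thesis
    by (rule that[of "t * (e * sinv t)"])
      (use conjugate_idempotent[OF e, of "sinv t"] mult_idempotent_eq_conjugate[OF e] s in auto)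
qed

lemma nle_refl [simp]: "s \<preceq> (s::'a::inverse_semigroup)"
  unfolding nle_def by (simp add: mult.assoc sinv_simps)

lemma nle_trans:
  fixes s :: "'a::inverse_semigroup"
  assumes "s \<preceq> t" and "t \<preceq> u"
  shows "s \<preceq> u"
proof -
  obtain e f where "e \<in> idempotents" "s = t * e" "f \<in> idempotents" "t = u * f"
    using assms by (metis nleE)
  then show ?thesis using mult_idempotent_nle[OF idempotent_mult, of f e u] by (simp add: mult.assoc)
qed

lemma nle_antisym:
  fixes s :: "'a::inverse_semigroup"
  assumes "s \<preceq> t" and "t \<preceq> s"
  shows "s = t"
proof -
  obtain e where e: "e \<in> idempotents" and s: "s = t * e" using assms(1) by (rule nleE)
  obtain f where f: "f \<in> idempotents" and t: "t = s * f" using assms(2) by (rule nleE)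
  have "t = t * e * f" using s t by simp
  then have "t * e = t * e * f * e" by simp
  also have "\<dots> = t * e * f"
    using idempotent_commute[OF e f] by (simp add: mult.assoc idempotentD[OF e])
  finally show ?thesis using s \<open>t = t * e * f\<close> by simp
qed

lemma nle_mult_left:
  fixes s :: "'a::inverse_semigroup"
  assumes "s \<preceq> t"
  shows "c * s \<preceq> c * t"
  using assms by (metis nleE mult.assoc mult_idempotent_nle)

lemma nle_mult_right:
  fixes s :: "'a::inverse_semigroup"
  assumes "s \<preceq> t"
  shows "s * c \<preceq> t * c"
  using assms by (metis nle_leftE mult.assoc idempotent_mult_nle)

lemma nle_mult:
  fixes s :: "'a::inverse_semigroup"
  shows "s \<preceq> t \<Longrightarrow> u \<preceq> v \<Longrightarrow> s * u \<preceq> t * v"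
  using nle_mult_left nle_mult_right nle_trans by metis

lemma nle_sinv:
  fixes s :: "'a::inverse_semigroup"
  assumes "s \<preceq> t"
  shows "sinv s \<preceq> sinv t"
  using assms by (metis nleE sinv_mult sinv_idempotent idempotent_mult_nle)

lemma nle_idempotent:
  fixes s :: "'a::inverse_semigroup"
  assumes "s \<preceq> e" and "e \<in> idempotents"
  shows "s \<in> idempotents"
  using assms by (metis nleE idempotent_mult)

section \<open>Joins, meets and complements\<close>

lemma zero_idempotent: "(0::'a::inverse_monoid) \<in> idempotents"
  and one_idempotent: "(1::'a) \<in> idempotents"
  by (simp_all add: idempotents_def)

lemma zero_nle [simp]: "0 \<preceq> (x::'a::inverse_monoid)"
  by (simp add: nle_def)

lemma nle_zeroD: "x \<preceq> 0 \<Longrightarrow> x = (0::'a::inverse_monoid)"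
  using nle_antisym zero_nle by blast

lemma nle_one_idempotent: "x \<preceq> 1 \<Longrightarrow> x \<in> idempotents" for x :: "'a::inverse_monoid"
  using nle_idempotent one_idempotent by blast

lemma idempotent_nle_one: "e \<in> idempotents \<Longrightarrow> e \<preceq> (1::'a::inverse_monoid)"
  using mult_idempotent_nle[of e 1] by simp

lemma is_joinI:
  assumes "\<And>x. x \<in> X \<Longrightarrow> x \<preceq> z" and "\<And>u. (\<And>x. x \<in> X \<Longrightarrow> x \<preceq> u) \<Longrightarrow> z \<preceq> u"
  shows "is_join X z"
  using assms unfolding is_join_def is_sup_def by blast

lemma is_joinD:
  assumes "is_join X z"
  shows "x \<in> X \<Longrightarrow> x \<preceq> z" and "(\<And>x. x \<in> X \<Longrightarrow> x \<preceq> u) \<Longrightarrow> z \<preceq> u"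
  using assms unfolding is_join_def is_sup_def by blast+

lemma is_meetD:
  assumes "is_meet {a, b} m"
  shows "m \<preceq> a" and "m \<preceq> b" and "u \<preceq> a \<Longrightarrow> u \<preceq> b \<Longrightarrow> u \<preceq> m"
  using assms unfolding is_meet_def is_inf_def by blast+

lemma is_join_insert:
  fixes z :: "'a::inverse_semigroup"
  assumes z: "is_join {a, b} z" and b: "is_join X b"
  shows "is_join (insert a X) z"
proof (rule is_joinI)
  fix x assume "x \<in> insert a X"
  then show "x \<preceq> z"
    using is_joinD(1)[OF z] is_joinD(1)[OF b] nle_trans by blast
next
  fix u assume u: "\<And>x. x \<in> insert a X \<Longrightarrow> x \<preceq> u"
  then have "b \<preceq> u" using is_joinD(2)[OF b] by blast
  then show "z \<preceq> u" using is_joinD(2)[OF z] u by blast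
qed

lemma is_join_insert_zero:
  fixes z :: "'a::inverse_monoid"
  shows "is_join (insert 0 X) z \<longleftrightarrow> is_join X z"
  unfolding is_join_def is_sup_def by auto

text \<open>The axiom gives a complement in the Boolean algebra of idempotents only. The join that exists
  by compatibility is below \<open>1\<close>, hence idempotent, hence equal to the join in that algebra. So
  the complement is one for joins taken in the whole monoid, where multiplication distributes.\<close>

lemma ex_complement:
  fixes e :: "'a::boolean_inverse_monoid"
  assumes e: "e \<in> idempotents"
  shows "\<exists>g. g \<in> idempotents \<and> e * g = 0 \<and> is_join {e, g} 1"
proof -
  let ?E = "idempotents :: 'a set"
  obtain bt tp join meet compl where
    bt: "bt \<in> ?E" and tp: "tp \<in> ?E" and bounds: "\<forall>x\<in>?E. bt \<preceq> x \<and> x \<preceq> tp"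
    and lat: "\<forall>x\<in>?E. \<forall>y\<in>?E. is_sup nle ?E {x, y} (join x y) \<and> is_inf nle ?E {x, y} (meet x y)"
    and compl: "\<forall>x\<in>?E. compl x \<in> ?E \<and> meet x (compl x) = bt \<and> join x (compl x) = tp"
    using idempotents_boolean[where ?'a = 'a] unfolding boolean_algebra_on_def by blast
  define g where "g = compl e"
  have g: "g \<in> ?E" and "meet e g = bt" and "join e g = tp" using compl e g_def by auto
  then have sup: "is_sup nle ?E {e, g} tp" and inf: "is_inf nle ?E {e, g} bt"
    using lat e by metis+
  have "bt = 0" using bounds zero_idempotent nle_zeroD by blast
  have "tp = 1"
    using bounds one_idempotent idempotent_nle_one[OF tp] nle_antisym by blast
  have "e * g \<preceq> e" and "e * g \<preceq> g"
    using mult_idempotent_nle[OF g] idempotent_mult_nle[OF e] by auto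
  then have "e * g \<preceq> bt"
    using inf idempotent_mult[OF e g] unfolding is_inf_def by blast
  then have eg: "e * g = 0" using \<open>bt = 0\<close> nle_zeroD by blast
  have "compatible e g"
    using e g idempotent_mult by (auto simp: compatible_def sinv_idempotent)
  then obtain j where j: "is_join {e, g} j" using compatible_join by blast
  have "j \<preceq> 1" using is_joinD(2)[OF j, of 1] e g idempotent_nle_one by blast
  moreover have "1 \<preceq> j"
    using sup nle_one_idempotent[OF \<open>j \<preceq> 1\<close>] is_joinD(1)[OF j] \<open>tp = 1\<close>
    unfolding is_sup_def by blast
  ultimately have "j = 1" by (rule nle_antisym)
  then show ?thesis using g eg j by blast
qed

definition idem_compl :: "'a::boolean_inverse_monoid \<Rightarrow> 'a" where
  "idem_compl e = (SOME g. g \<in> idempotents \<and> e * g = 0 \<and> is_join {e, g} 1)"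

lemma idem_compl:
  fixes e :: "'a::boolean_inverse_monoid"
  assumes "e \<in> idempotents"
  shows "idem_compl e \<in> idempotents" and "e * idem_compl e = 0" and "idem_compl e * e = 0"
    and "is_join {e, idem_compl e} 1"
proof -
  have *: "idem_compl e \<in> idempotents \<and> e * idem_compl e = 0 \<and> is_join {e, idem_compl e} 1"
    unfolding idem_compl_def by (rule someI_ex[OF ex_complement[OF assms]])
  then show "idem_compl e \<in> idempotents" and "e * idem_compl e = 0"
    and "is_join {e, idem_compl e} 1" by auto
  with assms show "idem_compl e * e = 0" using idempotent_commute by metis
qed

lemma idem_compl_cancel:
  fixes e :: "'a::boolean_inverse_monoid"
  assumes "e \<in> idempotents"
  shows "e * (idem_compl e * z) = 0" and "idem_compl e * (e * z) = 0"
  using idem_compl(2,3)[OF assms] by (metis mult.assoc mult_zero_left)+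

lemma split_by_idempotent:
  fixes x :: "'a::boolean_inverse_monoid"
  assumes "e \<in> idempotents"
  shows "is_join {x * e, x * idem_compl e} x"
  using mult_join_left[OF idem_compl(4)[OF assms], of x] by simp

lemma mult_idem_compl_eq:
  fixes x :: "'a::boolean_inverse_monoid"
  assumes "e \<in> idempotents" and "x * e = 0"
  shows "x * idem_compl e = x"
proof -
  have "is_join {x * idem_compl e} x"
    using split_by_idempotent[OF assms(1), of x] assms(2) by (simp add: is_join_insert_zero)
  then have "x \<preceq> x * idem_compl e" using is_joinD(2) by fastforce
  then show ?thesis using mult_idempotent_nle[OF idem_compl(1)[OF assms(1)]] nle_antisym by blast
qed

lemma idem_compl_mult_eq:
  fixes x :: "'a::boolean_inverse_monoid"
  assumes "e \<in> idempotents" and "idem_compl e * x = 0"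
  shows "e * x = x"
proof -
  have "is_join {idem_compl e * x, e * x} x"
    using mult_join_right[OF idem_compl(4)[OF assms(1)], of x] by (simp add: insert_commute)
  then have "is_join {e * x} x" using assms(2) by (simp add: is_join_insert_zero)
  then have "x \<preceq> e * x" using is_joinD(2) by fastforce
  then show ?thesis using idempotent_mult_nle[OF assms(1)] nle_antisym by blast
qed

section \<open>Ultrafilters\<close>

lemma proper_filterD:
  assumes "proper_filter A"
  shows "A \<noteq> {}" and "0 \<notin> A"
    and "a \<in> A \<Longrightarrow> b \<in> A \<Longrightarrow> is_meet {a, b} m \<Longrightarrow> m \<in> A"
    and "a \<in> A \<Longrightarrow> a \<preceq> t \<Longrightarrow> t \<in> A"
  using assms unfolding proper_filter_def by blast+

lemma proper_filter_lower_bound: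
  fixes A :: "'a::boolean_inverse_meet_monoid set"
  assumes "proper_filter A" and "a \<in> A" and "b \<in> A"
  obtains c where "c \<in> A" and "c \<preceq> a" and "c \<preceq> b"
proof -
  obtain m where m: "is_meet {a, b} m" using ex_meet by blast
  show ?thesis by (rule that[OF proper_filterD(3)[OF assms m] is_meetD(1,2)[OF m]])
qed

lemma proper_filter_up_closure:
  fixes B :: "'a::inverse_monoid set"
  assumes "B \<noteq> {}" and "0 \<notin> B"
    and directed: "\<And>a b. a \<in> B \<Longrightarrow> b \<in> B \<Longrightarrow> \<exists>c\<in>B. c \<preceq> a \<and> c \<preceq> b"
  shows "proper_filter (up_closure B)"
  unfolding proper_filter_def
proof (intro conjI ballI allI impI)
  show "up_closure B \<noteq> {}" using assms(1) nle_refl unfolding up_closure_def by blast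
  show "0 \<notin> up_closure B" using assms(2) nle_zeroD unfolding up_closure_def by blast
next
  fix a b m assume "a \<in> up_closure B" "b \<in> up_closure B" and m: "is_meet {a, b} m"
  then obtain x y where "x \<in> B" "x \<preceq> a" "y \<in> B" "y \<preceq> b" unfolding up_closure_def by blast
  moreover from this obtain c where "c \<in> B" "c \<preceq> x" "c \<preceq> y" using directed by blast
  ultimately show "m \<in> up_closure B"
    using is_meetD(3)[OF m] nle_trans unfolding up_closure_def by blast
next
  fix a t assume "a \<in> up_closure B" "a \<preceq> t"
  then show "t \<in> up_closure B" using nle_trans unfolding up_closure_def by blast
qed

lemma ultrafilterD:
  assumes "ultrafilter A"
  shows "proper_filter A" and "proper_filter B \<Longrightarrow> A \<subseteq> B \<Longrightarrow> B = A"
  using assms unfolding ultrafilter_def by blast+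

lemma ex_ultrafilter:
  fixes F :: "'a::inverse_monoid set"
  assumes F: "proper_filter F"
  obtains A where "ultrafilter A" and "F \<subseteq> A"
proof -
  let ?P = "{B. proper_filter B \<and> F \<subseteq> B}"
  have "\<exists>M\<in>?P. \<forall>X\<in>?P. M \<subseteq> X \<longrightarrow> X = M"
  proof (rule subset_Zorn_nonempty)
    show "?P \<noteq> {}" using F by blast
  next
    fix C assume "C \<noteq> {}" and C: "subset.chain ?P C"
    have filt: "proper_filter X" "F \<subseteq> X" if "X \<in> C" for X
      using C that unfolding subset_chain_def by auto
    obtain X0 where X0: "X0 \<in> C" using \<open>C \<noteq> {}\<close> by blast
    have "proper_filter (\<Union>C)"
      unfolding proper_filter_def
    proof (intro conjI ballI allI impI)
      show "\<Union>C \<noteq> {}" using proper_filterD(1)[OF filt(1)[OF X0]] X0 by blast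
      show "0 \<notin> \<Union>C" using proper_filterD(2)[OF filt(1)] by blast
    next
      fix a b m assume "a \<in> \<Union>C" "b \<in> \<Union>C" and m: "is_meet {a, b} m"
      then obtain X Y where XY: "X \<in> C" "a \<in> X" "Y \<in> C" "b \<in> Y" by blast
      have "X \<subseteq> Y \<or> Y \<subseteq> X" using C XY(1,3) unfolding subset_chain_def by simp
      then obtain Z where Z: "Z \<in> C" "a \<in> Z" "b \<in> Z" using XY by (meson subsetD)
      show "m \<in> \<Union>C" using proper_filterD(3)[OF filt(1)[OF Z(1)] Z(2,3) m] Z(1) by blast
    next
      fix a t assume "a \<in> \<Union>C" and at: "a \<preceq> t"
      then obtain Z where Z: "Z \<in> C" "a \<in> Z" by blast
      show "t \<in> \<Union>C" using proper_filterD(4)[OF filt(1)[OF Z(1)] Z(2) at] Z(1) by blast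
    qed
    moreover have "F \<subseteq> \<Union>C" using filt(2)[OF X0] X0 by blast
    ultimately show "\<Union>C \<in> ?P" by simp
  qed
  then obtain M where M: "proper_filter M" "F \<subseteq> M" and max: "\<forall>X\<in>?P. M \<subseteq> X \<longrightarrow> X = M"
    by auto
  have "X = M" if X: "proper_filter X" "M \<subseteq> X" for X
    using max X order_trans[OF M(2) X(2)] by simp
  then have "ultrafilter M" unfolding ultrafilter_def using M(1) by simp
  then show ?thesis using that M(2) by blast
qed

text \<open>If no \<open>a * e\<close> with \<open>a \<in> A\<close> vanishes, these elements generate a proper filter that contains
  \<open>A\<close>, and by maximality they all lie in \<open>A\<close>. If \<open>a * e = 0\<close>, then any \<open>b \<in> A\<close> has a lower bound
  \<open>c \<in> A\<close> that it shares with \<open>a\<close>, and \<open>c = c * idem_compl e\<close> lies below \<open>b * idem_compl e\<close>.\<close>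

lemma ultrafilter_idempotent_dichotomy:
  fixes A :: "'a::boolean_inverse_meet_monoid set"
  assumes A: "ultrafilter A" and e: "e \<in> idempotents"
  shows "(\<forall>a\<in>A. a * e \<in> A) \<or> (\<forall>a\<in>A. a * idem_compl e \<in> A)"
proof (cases "\<exists>a\<in>A. a * e = 0")
  case True
  then obtain a where a: "a \<in> A" "a * e = 0" by blast
  have "b * idem_compl e \<in> A" if b: "b \<in> A" for b
  proof -
    obtain c where c: "c \<in> A" "c \<preceq> a" "c \<preceq> b"
      using proper_filter_lower_bound[OF ultrafilterD(1)[OF A] a(1) b] .
    have "c * e = 0" using nle_mult_right[OF c(2), of e] a(2) nle_zeroD by metis
    then have "c = c * idem_compl e" using mult_idem_compl_eq[OF e] by simp
    then have "c \<preceq> b * idem_compl e" using nle_mult_right[OF c(3)] by metis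
    then show ?thesis using proper_filterD(4) ultrafilterD(1)[OF A] c(1) by blast
  qed
  then show ?thesis by blast
next
  case False
  let ?B = "(\<lambda>a. a * e) ` A"
  have "proper_filter (up_closure ?B)"
  proof (rule proper_filter_up_closure)
    show "?B \<noteq> {}" using proper_filterD(1) ultrafilterD(1)[OF A] by blast
    show "0 \<notin> ?B" using False by force
    fix x y assume "x \<in> ?B" "y \<in> ?B"
    then obtain a b where ab: "a \<in> A" "b \<in> A" "x = a * e" "y = b * e" by blast
    obtain c where "c \<in> A" "c \<preceq> a" "c \<preceq> b"
      using proper_filter_lower_bound[OF ultrafilterD(1)[OF A] ab(1,2)] .
    then show "\<exists>c\<in>?B. c \<preceq> x \<and> c \<preceq> y" using ab nle_mult_right by blast
  qed
  moreover have "A \<subseteq> up_closure ?B"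
    using mult_idempotent_nle[OF e] unfolding up_closure_def by blast
  ultimately have "up_closure ?B = A" using ultrafilterD(2)[OF A] by blast
  then show ?thesis unfolding up_closure_def using nle_refl by blast
qed

text \<open>Otherwise \<open>A\<close> would contain \<open>s * p\<close> for an idempotent \<open>p\<close> that annihilates every element
  of \<open>X\<close>. Then \<open>s * idem_compl p\<close> bounds \<open>X\<close> from above, hence bounds \<open>s\<close>, and \<open>s * p = 0\<close>.\<close>

lemma ultrafilter_finite_join_prime:
  fixes A :: "'a::boolean_inverse_meet_monoid set"
  assumes A: "ultrafilter A" and X: "finite X" and s: "is_join X s" "s \<in> A"
  shows "\<exists>x\<in>X. x \<in> A"
proof (rule ccontr)
  assume none: "\<not> ?thesis"
  have "\<exists>p\<in>idempotents. s * p \<in> A \<and> (\<forall>x\<in>Y. x * p = 0)" if "finite Y" "Y \<subseteq> X" for Y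
    using that
  proof (induction Y rule: finite_induct)
    case empty
    then show ?case using s(2) one_idempotent by (intro bexI[of _ 1]) auto
  next
    case (insert x Y)
    then obtain p where p: "p \<in> idempotents" "s * p \<in> A" "\<forall>x\<in>Y. x * p = 0" by auto
    let ?d = "sinv x * x"
    have d: "?d \<in> idempotents" by (rule domain_idempotent)
    have "x \<notin> A" using none insert.prems by blast
    moreover have "s * ?d = x" using is_joinD(1)[OF s(1)] insert.prems nleD by (metis insert_subset)
    ultimately have "\<forall>a\<in>A. a * idem_compl ?d \<in> A"
      using ultrafilter_idempotent_dichotomy[OF A d] s(2) by metis
    then have "s * (p * idem_compl ?d) \<in> A" using p(2) by (simp flip: mult.assoc)
    moreover have "x * (p * idem_compl ?d) = 0"
    proof -
      have "x * (p * idem_compl ?d) = x * (?d * (idem_compl ?d * p))"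
        using idempotent_commute[OF p(1) idem_compl(1)[OF d]]
        by (simp add: mult.assoc sinv_simps)
      then show ?thesis using idem_compl_cancel(1)[OF d] by simp
    qed
    moreover have "y * (p * idem_compl ?d) = 0" if "y \<in> Y" for y
      using p(3) that by (simp flip: mult.assoc)
    ultimately show ?case using idempotent_mult[OF p(1) idem_compl(1)[OF d]] by blast
  qed
  then obtain p where p: "p \<in> idempotents" "s * p \<in> A" "\<forall>x\<in>X. x * p = 0" using X by blast
  have "x \<preceq> s * idem_compl p" if "x \<in> X" for x
    using nle_mult_right[OF is_joinD(1)[OF s(1) that], of "idem_compl p"]
      mult_idem_compl_eq[OF p(1)] p(3) that by metis
  then have "s \<preceq> s * idem_compl p" using is_joinD(2)[OF s(1)] by blast
  then have "s * p \<preceq> s * idem_compl p * p" by (rule nle_mult_right)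
  then have "s * p = 0" using idem_compl(3)[OF p(1)] nle_zeroD by (simp add: mult.assoc)
  then show False using p(2) proper_filterD(2) ultrafilterD(1)[OF A] by metis
qed

section \<open>The groupoid of ultrafilters\<close>

abbreviation source_filter :: "'a::inverse_monoid set \<Rightarrow> 'a set" where
  "source_filter A \<equiv> up_closure (set_mult (sinv ` A) A)"

abbreviation target_filter :: "'a::inverse_monoid set \<Rightarrow> 'a set" where
  "target_filter A \<equiv> up_closure (set_mult A (sinv ` A))"

lemma source_filter_iff:
  fixes A :: "'a::boolean_inverse_meet_monoid set"
  assumes A: "proper_filter A"
  shows "x \<in> source_filter A \<longleftrightarrow> (\<exists>c\<in>A. sinv c * c \<preceq> x)"
proof
  assume "x \<in> source_filter A"
  then obtain a b where ab: "a \<in> A" "b \<in> A" "sinv a * b \<preceq> x"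
    unfolding up_closure_def set_mult_def by blast
  obtain c where "c \<in> A" "c \<preceq> a" "c \<preceq> b" using proper_filter_lower_bound[OF A ab(1,2)] .
  then show "\<exists>c\<in>A. sinv c * c \<preceq> x" using nle_mult nle_sinv ab(3) nle_trans by metis
next
  assume "\<exists>c\<in>A. sinv c * c \<preceq> x"
  then show "x \<in> source_filter A" unfolding up_closure_def set_mult_def by blast
qed

lemma target_filter_iff:
  fixes A :: "'a::boolean_inverse_meet_monoid set"
  assumes A: "proper_filter A"
  shows "x \<in> target_filter A \<longleftrightarrow> (\<exists>c\<in>A. c * sinv c \<preceq> x)"
proof
  assume "x \<in> target_filter A"
  then obtain a b where ab: "a \<in> A" "b \<in> A" "a * sinv b \<preceq> x"
    unfolding up_closure_def set_mult_def by blast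
  obtain c where "c \<in> A" "c \<preceq> a" "c \<preceq> b" using proper_filter_lower_bound[OF A ab(1,2)] .
  then show "\<exists>c\<in>A. c * sinv c \<preceq> x" using nle_mult nle_sinv ab(3) nle_trans by metis
next
  assume "\<exists>c\<in>A. c * sinv c \<preceq> x"
  then show "x \<in> target_filter A" unfolding up_closure_def set_mult_def by blast
qed

lemma principal_iff:
  "principal_groupoid (ultrafilter_groupoid :: 'a::boolean_inverse_meet_monoid set groupoid) \<longleftrightarrow>
     (\<forall>A::'a set. ultrafilter A \<longrightarrow> source_filter A = target_filter A \<longrightarrow>
        (\<exists>B. ultrafilter B \<and> A = source_filter B))"
  unfolding principal_groupoid_def identities_def ultrafilter_groupoid_def by auto

text \<open>An idempotent in \<open>A\<close> makes the idempotents cofinal in \<open>A\<close>, and each idempotent is its own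
  domain.\<close>

lemma source_filter_self:
  fixes A :: "'a::boolean_inverse_meet_monoid set"
  assumes A: "proper_filter A" and e: "e \<in> A" "e \<in> idempotents"
  shows "source_filter A = A"
proof -
  have below: "\<exists>c\<in>A. c \<preceq> a \<and> sinv c * c = c" if a: "a \<in> A" for a
  proof -
    obtain c where c: "c \<in> A" "c \<preceq> a" "c \<preceq> e" using proper_filter_lower_bound[OF A a e(1)] .
    then have "c \<in> idempotents" using nle_idempotent e(2) by blast
    then have "sinv c * c = c" by (simp add: sinv_idempotent idempotentD)
    then show ?thesis using c by blast
  qed
  show ?thesis
  proof (intro set_eqI iffI)
    fix x assume "x \<in> source_filter A"
    then obtain a where a: "a \<in> A" "sinv a * a \<preceq> x" using source_filter_iff[OF A] by blast
    then obtain c where c: "c \<in> A" "c \<preceq> a" "sinv c * c = c" using below by blast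
    then have "c \<preceq> x" using nle_mult[OF nle_sinv[OF c(2)] c(2)] a(2) nle_trans by metis
    then show "x \<in> A" using proper_filterD(4)[OF A] c(1) by blast
  next
    fix x assume "x \<in> A"
    then show "x \<in> source_filter A" using source_filter_iff[OF A] below by metis
  qed
qed

lemma identity_has_idempotent:
  fixes B :: "'a::boolean_inverse_meet_monoid set"
  assumes "proper_filter B"
  obtains e where "e \<in> source_filter B" and "e \<in> idempotents"
  using assms proper_filterD(1) source_filter_iff domain_idempotent nle_refl
  by (metis ex_in_conv)

text \<open>An element of square zero has orthogonal domain and range, which could not both lie in the
  proper filter \<open>source_filter A = target_filter A\<close>.\<close>

lemma isotropy_no_square_zero:
  fixes A :: "'a::boolean_inverse_meet_monoid set"
  assumes A: "proper_filter A" and eq: "source_filter A = target_filter A"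
    and s: "s \<in> A" "s * s = 0"
  shows False
proof -
  have "s * sinv s \<in> source_filter A" using eq target_filter_iff[OF A] s(1) nle_refl by metis
  then obtain a where a: "a \<in> A" "sinv a * a \<preceq> s * sinv s" using source_filter_iff[OF A] by blast
  obtain c where c: "c \<in> A" "c \<preceq> a" "c \<preceq> s" using proper_filter_lower_bound[OF A a(1) s(1)] .
  let ?d = "sinv c * c"
  have "?d \<preceq> sinv s * s" using nle_mult nle_sinv c(3) by metis
  moreover have "?d \<preceq> s * sinv s" using nle_mult nle_sinv c(2) a(2) nle_trans by metis
  ultimately have "?d * ?d \<preceq> (sinv s * s) * (s * sinv s)" by (rule nle_mult)
  also have "(sinv s * s) * (s * sinv s) = sinv s * (s * s) * sinv s" by (simp add: mult.assoc)
  finally have "?d = 0" using s(2) idempotentD(1)[OF domain_idempotent, of c] nle_zeroD[of ?d] by simp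
  then have "c = 0" using sinv_sandwich(1)[of c] by simp
  then show False using c(1) proper_filterD(2)[OF A] by blast
qed

text \<open>Say \<open>f = sinv c * c\<close> with \<open>c \<in> A\<close> lies in the source but not in the target. Then the part
  of \<open>c\<close> with range under \<open>f\<close> is not in \<open>A\<close>, so by the dichotomy the remaining part
  \<open>idem_compl f * c\<close> is. It maps a part of \<open>f\<close> to a part of the complement of \<open>f\<close>, so its square
  vanishes. The other case is dual.\<close>

lemma anisotropic_has_square_zero:
  fixes A :: "'a::boolean_inverse_meet_monoid set"
  assumes A: "ultrafilter A" and neq: "source_filter A \<noteq> target_filter A"
  obtains b where "b \<in> A" and "b * b = 0"
proof -
  note F = ultrafilterD(1)[OF A]
  have up: "z \<in> source_filter A" if "y \<in> source_filter A" "y \<preceq> z" for y z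
    using that nle_trans unfolding up_closure_def by blast
  have up': "z \<in> target_filter A" if "y \<in> target_filter A" "y \<preceq> z" for y z
    using that nle_trans unfolding up_closure_def by blast
  consider x where "x \<in> source_filter A" "x \<notin> target_filter A"
    | x where "x \<in> target_filter A" "x \<notin> source_filter A" using neq by blast
  then show ?thesis
  proof cases
    case 1
    then obtain c where c: "c \<in> A" "sinv c * c \<preceq> x" using source_filter_iff[OF F] by blast
    define f where "f = sinv c * c"
    have f: "f \<in> idempotents" unfolding f_def by (rule domain_idempotent)
    have cf: "c * f = c" unfolding f_def by (simp add: sinv_simps)
    have notin: "f \<notin> target_filter A" using 1(2) c(2) up' f_def by blast
    \<comment> \<open>Conjugating by \<open>c\<close> turns the left factor \<open>idem_compl f\<close> into a right factor \<open>g\<close>.\<close>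
    define g where "g = sinv c * (idem_compl f * c)"
    have g: "g \<in> idempotents" unfolding g_def by (rule conjugate_idempotent[OF idem_compl(1)[OF f]])
    have cg: "c * g = idem_compl f * c"
      unfolding g_def by (rule idempotent_mult_eq_conjugate[OF idem_compl(1)[OF f], symmetric])
    have "c * idem_compl g \<notin> A"
    proof
      let ?a = "c * idem_compl g"
      assume "?a \<in> A"
      have "idem_compl f * ?a = c * g * idem_compl g" using cg by (simp add: mult.assoc)
      then have "idem_compl f * ?a = 0" using idem_compl(2)[OF g] by (simp add: mult.assoc)
      then have fa: "f * ?a = ?a" by (rule idem_compl_mult_eq[OF f])
      have "?a * sinv ?a = f * (?a * sinv ?a)" using fa by (simp flip: mult.assoc)
      then have "?a * sinv ?a \<preceq> f" using mult_idempotent_nle[OF range_idempotent] by metis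
      then show False using notin target_filter_iff[OF F] \<open>?a \<in> A\<close> by blast
    qed
    then have "idem_compl f * c \<in> A"
      using ultrafilter_idempotent_dichotomy[OF A g] c(1) cg by metis
    moreover have "idem_compl f * c * (idem_compl f * c) = 0"
    proof -
      have "idem_compl f * c * (idem_compl f * c) = idem_compl f * ((c * f) * (idem_compl f * c))"
        by (simp add: cf mult.assoc)
      then show ?thesis by (simp add: mult.assoc idem_compl_cancel[OF f])
    qed
    ultimately show ?thesis using that by blast
  next
    case 2
    then obtain c where c: "c \<in> A" "c * sinv c \<preceq> x" using target_filter_iff[OF F] by blast
    define f where "f = c * sinv c"
    have f: "f \<in> idempotents" unfolding f_def by (rule range_idempotent)
    have fc: "f * c = c" unfolding f_def by (simp add: mult.assoc sinv_simps)
    have notin: "f \<notin> source_filter A" using 2(2) c(2) up f_def by blast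
    have "c * f \<notin> A"
    proof
      assume "c * f \<in> A"
      have "sinv (c * f) * (c * f) = f * (sinv c * c * f)"
        by (simp add: sinv_mult sinv_idempotent[OF f] mult.assoc)
      then have "sinv (c * f) * (c * f) \<preceq> f"
        using mult_idempotent_nle[OF idempotent_mult[OF domain_idempotent f]] by metis
      then show False using notin source_filter_iff[OF F] \<open>c * f \<in> A\<close> by blast
    qed
    then have "c * idem_compl f \<in> A"
      using ultrafilter_idempotent_dichotomy[OF A f] c(1) by metis
    moreover have "c * idem_compl f * (c * idem_compl f) = 0"
    proof -
      have "c * idem_compl f * (c * idem_compl f) = c * (idem_compl f * ((f * c) * idem_compl f))"
        by (simp add: fc mult.assoc)
      then show ?thesis by (simp add: mult.assoc idem_compl_cancel[OF f])
    qed
    ultimately show ?thesis using that by blast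
  qed
qed

section \<open>Covering by infinitesimals\<close>

definition compl_prod :: "'a::boolean_inverse_monoid list \<Rightarrow> 'a" where
  "compl_prod fs = prod_list (map idem_compl fs)"

lemma compl_prod_idempotent: "set fs \<subseteq> idempotents \<Longrightarrow> compl_prod fs \<in> idempotents"
  unfolding compl_prod_def
  by (induction fs) (auto simp: one_idempotent intro: idempotent_mult idem_compl(1))

lemma compl_prod_append: "compl_prod (fs @ gs) = compl_prod fs * compl_prod gs"
  unfolding compl_prod_def by simp

text \<open>Cutting off \<open>x * f\<close> for the first \<open>f\<close> in the list leaves \<open>x * idem_compl f\<close>, which is
  orthogonal to it, and one goes on with the latter.\<close>

lemma orthogonal_infinitesimals_cover:
  fixes x :: "'a::boolean_inverse_monoid"
  assumes "set fs \<subseteq> idempotents" and "\<forall>f\<in>set fs. (x * f) * (x * f) = 0"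
  shows "\<exists>X. finite X \<and> (\<forall>y\<in>X. infinitesimal y) \<and> pairwise orthogonal X \<and>
           is_join (insert (x * compl_prod fs) X) x"
  using assms
proof (induction fs arbitrary: x)
  case Nil
  have "is_join {x} x" by (rule is_joinI) auto
  then show ?case by (intro exI[of _ "{}"]) (simp add: compl_prod_def)
next
  case (Cons f fs)
  define z where "z = x * idem_compl f"
  have f: "f \<in> idempotents" and fs: "set fs \<subseteq> idempotents" using Cons.prems by auto
  note f' = idem_compl(1)[OF f]
  have "(z * g) * (z * g) = 0" if "g \<in> set fs" for g
  proof -
    have g: "g \<in> idempotents" using that fs by blast
    have "z * g = x * g * idem_compl f"
      unfolding z_def using idempotent_commute[OF g f'] by (simp add: mult.assoc)
    then have "z * g \<preceq> x * g" using mult_idempotent_nle[OF f'] by metis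
    then have "(z * g) * (z * g) \<preceq> (x * g) * (x * g)" using nle_mult by blast
    then show ?thesis using Cons.prems(2) that nle_zeroD by (metis list.set_intros(2))
  qed
  then obtain X where X: "finite X" "\<forall>y\<in>X. infinitesimal y" "pairwise orthogonal X"
    and join: "is_join (insert (z * compl_prod fs) X) z"
    using Cons.IH[OF fs] by blast
  have z: "z * compl_prod fs = x * compl_prod (f # fs)"
    unfolding z_def compl_prod_def by (simp add: mult.assoc)
  have "is_join {x * f, z} x" unfolding z_def by (rule split_by_idempotent[OF f])
  then have join': "is_join (insert (x * f) (insert (x * compl_prod (f # fs)) X)) x"
    using is_join_insert join z by metis
  show ?case
  proof (cases "x * f = 0")
    case True
    then show ?thesis using X join' by (auto simp: is_join_insert_zero)
  next
    case False
    then have "infinitesimal (x * f)" using Cons.prems(2) unfolding infinitesimal_def by simp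
    moreover have "orthogonal (x * f) y \<and> orthogonal y (x * f)" if "y \<in> X" for y
    proof -
      have "y \<preceq> z" using is_joinD(1)[OF join] that by blast
      then obtain h where h: "h \<in> idempotents" and y: "y = x * idem_compl f * h"
        using nleE z_def by metis
      have swap: "f * (sinv x * (x * u)) = sinv x * (x * (f * u))"
        and swap': "idem_compl f * (sinv x * (x * u)) = sinv x * (x * (idem_compl f * u))"
        and hf: "f * (h * u) = h * (f * u)" and hf': "idem_compl f * (h * u) = h * (idem_compl f * u)"
        for u
        using idempotent_left_commute[OF f domain_idempotent[of x], of u]
          idempotent_left_commute[OF f' domain_idempotent[of x], of u]
          idempotent_left_commute[OF f h] idempotent_left_commute[OF f' h]
        by (simp_all add: mult.assoc)
      show ?thesis
        unfolding orthogonal_def y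
        by (simp add: sinv_mult sinv_idempotent f f' h mult.assoc swap swap' hf hf'
              idem_compl_cancel idem_compl)
    qed
    ultimately have "\<forall>y\<in>insert (x * f) X. infinitesimal y"
      and "pairwise orthogonal (insert (x * f) X)"
      using X(2,3) by (auto simp: pairwise_insert)
    moreover have "is_join (insert (x * compl_prod (f # fs)) (insert (x * f) X)) x"
      using join' by (simp add: insert_commute)
    ultimately show ?thesis using X(1) by blast
  qed
qed

text \<open>If no finite product of complements annihilated \<open>t\<close>, then
  the elements \<open>t * compl_prod fs\<close> would generate a proper filter. An ultrafilter \<open>A\<close> above it
  contains \<open>t\<close>, hence no idempotent by hypothesis on \<open>t\<close>, so it is not an identity and in a principal groupoid its
  source and target differ. Thus some square-zero \<open>b \<le> t\<close> lies in \<open>A\<close>. But so does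
  \<open>t * idem_compl (sinv b * b)\<close>, which meets \<open>b\<close> in \<open>0\<close>.\<close>

lemma principal_compact_cover:
  fixes t :: "'a::boolean_inverse_meet_monoid"
  assumes pr: "principal_groupoid (ultrafilter_groupoid :: 'a set groupoid)"
    and fixfree: "\<And>e. e \<in> idempotents \<Longrightarrow> e \<preceq> t \<Longrightarrow> e = 0"
  obtains fs where "set fs \<subseteq> idempotents" and "\<forall>f\<in>set fs. (t * f) * (t * f) = 0"
    and "t * compl_prod fs = 0"
proof (rule ccontr)
  assume contr: "\<not> thesis"
  define L where "L = {fs. set fs \<subseteq> idempotents \<and> (\<forall>f\<in>set fs. (t * f) * (t * f) = 0)}"
  define B where "B = (\<lambda>fs. t * compl_prod fs) ` L"
  have inB: "t * compl_prod fs \<in> B" if "fs \<in> L" for fs using that B_def by blast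
  have "proper_filter (up_closure B)"
  proof (rule proper_filter_up_closure)
    show "B \<noteq> {}" unfolding B_def L_def by (auto intro: exI[of _ "[]"])
    show "0 \<notin> B" using contr that unfolding B_def L_def by force
    fix x y assume "x \<in> B" "y \<in> B"
    then obtain fs gs where fs: "fs \<in> L" "x = t * compl_prod fs"
      and gs: "gs \<in> L" "y = t * compl_prod gs" unfolding B_def by blast
    have I: "compl_prod fs \<in> idempotents" "compl_prod gs \<in> idempotents"
      using fs(1) gs(1) compl_prod_idempotent unfolding L_def by auto
    have "t * compl_prod (fs @ gs) = x * compl_prod gs"
      "t * compl_prod (fs @ gs) = y * compl_prod fs"
      using idempotent_commute[OF I] by (simp_all add: compl_prod_append mult.assoc fs(2) gs(2))
    then have "t * compl_prod (fs @ gs) \<preceq> x" "t * compl_prod (fs @ gs) \<preceq> y"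
      using mult_idempotent_nle I by metis+
    moreover have "fs @ gs \<in> L" using fs(1) gs(1) unfolding L_def by auto
    ultimately show "\<exists>c\<in>B. c \<preceq> x \<and> c \<preceq> y" using inB by blast
  qed
  then obtain A where A: "ultrafilter A" and BA: "up_closure B \<subseteq> A" using ex_ultrafilter by blast
  note F = ultrafilterD(1)[OF A]
  have inA: "t * compl_prod fs \<in> A" if "fs \<in> L" for fs
    using inB[OF that] BA nle_refl unfolding up_closure_def by blast
  have tA: "t \<in> A" using inA[of "[]"] unfolding L_def compl_prod_def by simp
  have "e \<notin> A" if "e \<in> idempotents" for e
  proof
    assume "e \<in> A"
    from proper_filter_lower_bound[OF F tA this]
    obtain c where "c \<in> A" "c \<preceq> t" "c \<preceq> e" .
    then show False using fixfree nle_idempotent[OF _ that] proper_filterD(2)[OF F] by blast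
  qed
  then have "source_filter A \<noteq> target_filter A"
    using pr A identity_has_idempotent ultrafilterD(1) unfolding principal_iff by metis
  then obtain b' where b': "b' \<in> A" "b' * b' = 0" using anisotropic_has_square_zero[OF A] by blast
  obtain b where b: "b \<in> A" "b \<preceq> t" "b \<preceq> b'" using proper_filter_lower_bound[OF F tA b'(1)] .
  have "b * b = 0" using nle_mult[OF b(3) b(3)] b'(2) nle_zeroD by metis
  let ?d = "sinv b * b"
  have d: "?d \<in> idempotents" by (rule domain_idempotent)
  have "t * ?d = b" using nleD[OF b(2)] by simp
  then have "[?d] \<in> L" using \<open>b * b = 0\<close> d unfolding L_def by simp
  then have "t * idem_compl ?d \<in> A" using inA[of "[?d]"] by (simp add: compl_prod_def)
  from proper_filter_lower_bound[OF F b(1) this]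
  obtain c where c: "c \<in> A" "c \<preceq> b" "c \<preceq> t * idem_compl ?d" .
  have "c * ?d \<preceq> t * idem_compl ?d * ?d" using nle_mult_right[OF c(3)] .
  then have "c * ?d = 0" using idem_compl(3)[OF d] nle_zeroD by (simp add: mult.assoc)
  moreover have "c * ?d = c"
  proof -
    obtain h where "h \<in> idempotents" "c = h * b" using c(2) by (rule nle_leftE)
    then show ?thesis by (simp add: mult.assoc sinv_simps)
  qed
  ultimately show False using c(1) proper_filterD(2)[OF F] by simp
qed

text \<open>The idempotent part is \<open>e = s \<and> 1\<close>. Nothing idempotent is left below
  \<open>s * idem_compl e\<close>, so the compactness argument applies to it.\<close>

lemma principal_imp_orthogonal_decomposition:
  fixes s :: "'a::boolean_inverse_meet_monoid"
  assumes pr: "principal_groupoid (ultrafilter_groupoid :: 'a set groupoid)"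
  shows "\<exists>e m f. infinitesimal_decomposition s e m f \<and>
           (\<forall>i\<in>{1..m}. \<forall>j\<in>{1..m}. i \<noteq> j \<longrightarrow> orthogonal (f i) (f j))"
proof -
  obtain e where m: "is_meet {s, 1} e" using ex_meet by blast
  have es: "e \<preceq> s" and e: "e \<in> idempotents" using is_meetD(1,2)[OF m] nle_one_idempotent by auto
  note e' = idem_compl(1)[OF e]
  have se: "s * e = e"
    using nleD[OF es] by (simp add: sinv_idempotent[OF e] idempotentD[OF e])
  have "e * s = e"
    using nle_leftE[OF es] idempotentD e idempotent_commute
    by (metis mult.assoc se)
  define t where "t = s * idem_compl e"
  have join: "is_join {e, t} s"
    using split_by_idempotent[OF e, of s] se t_def by simp
  have orth: "orthogonal e t"
    unfolding orthogonal_def t_def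
    using \<open>e * s = e\<close> idem_compl(2)[OF e]
    by (simp add: sinv_mult sinv_idempotent e e' idem_compl_cancel flip: mult.assoc)
  have "h = 0" if h: "h \<in> idempotents" "h \<preceq> t" for h
  proof -
    have "h \<preceq> s" using h(2) mult_idempotent_nle[OF e'] nle_trans t_def by blast
    then have "h \<preceq> e" using is_meetD(3)[OF m] idempotent_nle_one h(1) by blast
    then have "h * h \<preceq> t * e" using nle_mult h(2) by blast
    then show ?thesis
      using nle_zeroD idem_compl(3)[OF e] by (simp add: t_def mult.assoc idempotentD[OF h(1)])
  qed
  then obtain fs where fs: "set fs \<subseteq> idempotents" "\<forall>f\<in>set fs. (t * f) * (t * f) = 0"
    and "t * compl_prod fs = 0" using principal_compact_cover[OF pr] by metis
  then obtain X where X: "finite X" "\<forall>y\<in>X. infinitesimal y" "pairwise orthogonal X" "is_join X t"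
    using orthogonal_infinitesimals_cover[OF fs] by (auto simp: is_join_insert_zero)
  obtain f where f: "bij_betw f {1..card X} X"
    using ex_bij_betw_nat_finite_1[OF X(1)] by blast
  then have img: "f ` {1..card X} = X" by (simp add: bij_betw_def)
  have "infinitesimal_decomposition s e (card X) f"
    unfolding infinitesimal_decomposition_def img
    using e X(2,4) orth is_join_insert[OF join X(4)] img by blast
  moreover have "\<forall>i\<in>{1..card X}. \<forall>j\<in>{1..card X}. i \<noteq> j \<longrightarrow> orthogonal (f i) (f j)"
    using X(3) f unfolding bij_betw_def pairwise_def inj_on_def by blast
  ultimately show ?thesis by blast
qed

lemma decomposition_imp_principal:
  assumes dec: "\<forall>s::'a::boolean_inverse_meet_monoid. \<exists>e m f. infinitesimal_decomposition s e m f"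
  shows "principal_groupoid (ultrafilter_groupoid :: 'a set groupoid)"
  unfolding principal_iff
proof (intro allI impI)
  fix A :: "'a set"
  assume A: "ultrafilter A" and eq: "source_filter A = target_filter A"
  note F = ultrafilterD(1)[OF A]
  obtain s where s: "s \<in> A" using proper_filterD(1)[OF F] by blast
  obtain e m f where "infinitesimal_decomposition s e m f" using dec by blast
  then have e: "e \<in> idempotents" and inf: "\<forall>i\<in>{1..m}. infinitesimal (f i)"
    and join: "is_join (insert e (f ` {1..m})) s"
    unfolding infinitesimal_decomposition_def by auto
  obtain x where x: "x \<in> insert e (f ` {1..m})" "x \<in> A"
    using ultrafilter_finite_join_prime[OF A _ join s] by blast
  have "x * x \<noteq> 0" using isotropy_no_square_zero[OF F eq x(2)] by blast
  then have "x = e" using x(1) inf unfolding infinitesimal_def by auto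
  then show "\<exists>B. ultrafilter B \<and> A = source_filter B"
    using source_filter_self[OF F] x(2) e A by metis
qed

theorem theorem4p28:
  shows "(principal_groupoid (ultrafilter_groupoid :: 'a::boolean_inverse_meet_monoid set groupoid)
            \<longleftrightarrow> (\<forall>s::'a. \<exists>e m f. infinitesimal_decomposition s e m f))
       \<and> (principal_groupoid (ultrafilter_groupoid :: 'a set groupoid)
            \<longrightarrow> (\<forall>s::'a. \<exists>e m f. infinitesimal_decomposition s e m f \<and>
                   (\<forall>i\<in>{1..m}. \<forall>j\<in>{1..m}. i \<noteq> j \<longrightarrow> orthogonal (f i) (f j))))"
  using principal_imp_orthogonal_decomposition decomposition_imp_principal by blast

end
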